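(* Let $(\alpha_t)_{t\ge0}$ be a strongly continuous semigroup of bounded Malcev algebra morphisms on a Banach--Malcev algebra $(\mathcal{M},[\cdot,\cdot])$. For each $t\ge0$ define $[x,y]_t:=\alpha_t([x,y])$ for $x,y\in\mathcal{M}$. Then, for each $t\ge 0$, $(\mathcal{M},[\cdot,\cdot]_t,\alpha_t)$ is a Hom--Banach--Malcev algebra, and the map $t\mapsto[x,y]_t$ is norm continuous for all fixed $x,y\in\mathcal{M}$.
   Context: A Malcev bracket on a complex vector space is a bilinear skew-symmetric bracket satisfying the Malcev identity $J(x,y,[x,z])=[J(x,y,z),x]$, where $J(x,y,z)=[x,[y,z]]+[y,[z,x]]+[z,[x,y]]$. A Banach--Malcev algebra is a complex Banach space with a continuous Malcev bracket. A linear map $\alpha$ is a Malcev algebra morphism if $\alpha([x,y])=[\alpha(x),\alpha(y)]$ for all $x,y$. A Hom--Banach--Malcev algebra $(\mathcal{M},[\cdot,\cdot]_\alpha,\alpha)$ is a complex Banach space $\mathcal{M}$ with a bounded linear map $\alpha$ and a continuous bilinear bracket $[\cdot,\cdot]_\alpha$ such that $[x,y]_\alpha=\alpha([x,y])$ for a continuous Malcev bracket $[\cdot,\cdot]$ on $\mathcal{M}$, and such that the Hom--Malcev identity \[ J_\alpha(\alpha(x),\alpha(y),[x,z]_\alpha)=[J_\alpha(x,y,z),\alpha^2(x)]_\alpha \] holds for all $x,y,z$, where $J_\alpha(x,y,z):=[\alpha(x),[y,z]_\alpha]_\alpha+[\alpha(y),[z,x]_\alpha]_\alpha+[\alpha(z),[x,y]_\alpha]_\alpha$.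 *)

theory Defs
  imports "HOL-Analysis.Analysis"
begin

text \<open>
  HOL-Analysis has only real Banach spaces; a complex one is a real one with a compatible complex
  scalar multiplication that makes the norm absolutely homogeneous over the complex numbers.
\<close>

class complex_vector = real_vector +
  fixes scaleC :: "complex \<Rightarrow> 'a \<Rightarrow> 'a"  (infixr \<open>*\<^sub>C\<close> 75)
  assumes scaleC_add_right: "a *\<^sub>C (x + y) = a *\<^sub>C x + a *\<^sub>C y"
    and scaleC_add_left: "(a + b) *\<^sub>C x = a *\<^sub>C x + b *\<^sub>C x"
    and scaleC_scaleC: "a *\<^sub>C b *\<^sub>C x = (a * b) *\<^sub>C x"
    and scaleC_one: "1 *\<^sub>C x = x"
    and scaleR_scaleC: "r *\<^sub>R x = complex_of_real r *\<^sub>C x"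

class complex_normed_vector = complex_vector + real_normed_vector +
  assumes norm_scaleC: "norm (a *\<^sub>C x) = cmod a * norm x"

class complex_banach = complex_normed_vector + banach

instantiation complex :: complex_banach
begin

definition scaleC_complex :: "complex \<Rightarrow> complex \<Rightarrow> complex" where
  "scaleC_complex a x = a * x"

instance
  by standard (simp_all add: scaleC_complex_def algebra_simps scaleR_conv_of_real norm_mult)

end

lemma vector_space_scaleC: "vector_space (scaleC :: complex \<Rightarrow> 'a::complex_vector \<Rightarrow> 'a)"
  by unfold_locales
    (simp_all add: scaleC_add_right scaleC_add_left scaleC_scaleC scaleC_one)

abbreviation clinear :: "('a::complex_vector \<Rightarrow> 'b::complex_vector) \<Rightarrow> bool" where
  "clinear \<equiv> Vector_Spaces.linear scaleC scaleC"

definition bounded_clinear ::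
    "('a::complex_normed_vector \<Rightarrow> 'b::complex_normed_vector) \<Rightarrow> bool" where
  "bounded_clinear f \<longleftrightarrow> clinear f \<and> (\<exists>K. \<forall>x. norm (f x) \<le> norm x * K)"

definition continuous_cbilinear ::
    "('a::complex_normed_vector \<Rightarrow> 'a \<Rightarrow> 'a) \<Rightarrow> bool" where
  "continuous_cbilinear br \<longleftrightarrow>
     (\<forall>y. clinear (\<lambda>x. br x y)) \<and> (\<forall>x. clinear (\<lambda>y. br x y)) \<and>
     continuous_on UNIV (\<lambda>(x, y). br x y)"

definition malcev_J :: "('a::ab_group_add \<Rightarrow> 'a \<Rightarrow> 'a) \<Rightarrow> 'a \<Rightarrow> 'a \<Rightarrow> 'a \<Rightarrow> 'a" where
  "malcev_J br x y z = br x (br y z) + br y (br z x) + br z (br x y)"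

definition banach_malcev_algebra :: "('a::complex_banach \<Rightarrow> 'a \<Rightarrow> 'a) \<Rightarrow> bool" where
  "banach_malcev_algebra br \<longleftrightarrow>
     continuous_cbilinear br \<and>
     (\<forall>x y. br x y = - br y x) \<and>
     (\<forall>x y z. malcev_J br x y (br x z) = br (malcev_J br x y z) x)"

definition malcev_morphism :: "('a::complex_vector \<Rightarrow> 'a \<Rightarrow> 'a) \<Rightarrow> ('a \<Rightarrow> 'a) \<Rightarrow> bool" where
  "malcev_morphism br \<alpha> \<longleftrightarrow> clinear \<alpha> \<and> (\<forall>x y. \<alpha> (br x y) = br (\<alpha> x) (\<alpha> y))"

definition hom_malcev_J ::
    "('a::ab_group_add \<Rightarrow> 'a \<Rightarrow> 'a) \<Rightarrow> ('a \<Rightarrow> 'a) \<Rightarrow> 'a \<Rightarrow> 'a \<Rightarrow> 'a \<Rightarrow> 'a" where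
  "hom_malcev_J bra \<alpha> x y z =
     bra (\<alpha> x) (bra y z) + bra (\<alpha> y) (bra z x) + bra (\<alpha> z) (bra x y)"

text \<open>
  \<open>bra\<close> is the twisted bracket; the untwisted Malcev bracket is not part of the structure, it is
  only required to exist.
\<close>

definition hom_banach_malcev_algebra ::
    "('a::complex_banach \<Rightarrow> 'a \<Rightarrow> 'a) \<Rightarrow> ('a \<Rightarrow> 'a) \<Rightarrow> bool" where
  "hom_banach_malcev_algebra bra \<alpha> \<longleftrightarrow>
     bounded_clinear \<alpha> \<and>
     continuous_cbilinear bra \<and>
     (\<exists>br. banach_malcev_algebra br \<and> (\<forall>x y. bra x y = \<alpha> (br x y))) \<and>
     (\<forall>x y z. hom_malcev_J bra \<alpha> (\<alpha> x) (\<alpha> y) (bra x z) =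
        bra (hom_malcev_J bra \<alpha> x y z) (\<alpha> (\<alpha> x)))"

text \<open>
  A \<open>C\<^sub>0\<close>-semigroup of bounded operators. Only the values at \<open>t \<ge> 0\<close> matter. As
  usual, strong continuity is required at \<open>t = 0\<close> only; on a Banach space, continuity of all
  orbits on \<open>{0..}\<close> is a consequence (uniform boundedness principle).
\<close>

definition strongly_continuous_semigroup ::
    "(real \<Rightarrow> 'a::complex_banach \<Rightarrow> 'a) \<Rightarrow> bool" where
  "strongly_continuous_semigroup \<alpha> \<longleftrightarrow>
     (\<forall>t\<ge>0. bounded_clinear (\<alpha> t)) \<and>
     (\<forall>x. \<alpha> 0 x = x) \<and>
     (\<forall>s\<ge>0. \<forall>t\<ge>0. \<forall>x. \<alpha> (s + t) x = \<alpha> s (\<alpha> t x)) \<and>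
     (\<forall>x. ((\<lambda>t. \<alpha> t x) \<longlongrightarrow> x) (at_right 0))"

end

theory Submission
  imports Defs
begin

text \<open>
  For a morphism \<open>f\<close> of the Malcev bracket, the twisted Jacobian is \<open>f\<^sup>2 \<circ> J\<close>, so both sides of the
  Hom-Malcev identity are the images under \<open>f\<^sup>3\<close> of the two sides of the Malcev identity.
  For the orbits, the Baire category theorem turns strong continuity at \<open>0\<close> into a uniform bound on
  the operators near \<open>0\<close>, which the semigroup law spreads to every compact interval; then
  \<open>\<alpha> (s + h) x - \<alpha> s x = \<alpha> s (\<alpha> h x - x)\<close> gives continuity from both sides.
\<close>

section \<open>Twisting a Malcev bracket by a morphism\<close>

lemma bounded_clinear_imp_bounded_linear:
  assumes "bounded_clinear f"
  shows "bounded_linear f"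
proof -
  interpret Vector_Spaces.linear scaleC scaleC f
    using assms by (simp add: bounded_clinear_def)
  show ?thesis
    using assms by unfold_locales (auto simp: bounded_clinear_def add scale scaleR_scaleC)
qed

lemma clinear_compose: "clinear f \<Longrightarrow> clinear g \<Longrightarrow> clinear (\<lambda>x. f (g x))"
  using Vector_Spaces.linear_compose[of scaleC scaleC g scaleC f] by (simp add: o_def)

lemma continuous_cbilinear_compose:
  assumes f: "bounded_clinear f" and br: "continuous_cbilinear br"
  shows "continuous_cbilinear (\<lambda>x y. f (br x y))"
proof -
  have lin: "clinear f" "clinear (\<lambda>x. br x y)" "clinear (\<lambda>y. br x y)" for x y
    using f br by (simp_all add: bounded_clinear_def continuous_cbilinear_def)
  have "continuous_on UNIV (\<lambda>p. f (case p of (x, y) \<Rightarrow> br x y))"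
    by (rule bounded_linear.continuous_on[OF bounded_clinear_imp_bounded_linear[OF f]])
      (use br in \<open>simp add: continuous_cbilinear_def\<close>)
  then show ?thesis
    unfolding continuous_cbilinear_def
    by (simp add: clinear_compose[OF lin(1) lin(2)] clinear_compose[OF lin(1) lin(3)]
        case_prod_unfold)
qed

lemma hom_malcev_J_twist:
  assumes f: "malcev_morphism br f"
  shows "hom_malcev_J (\<lambda>x y. f (br x y)) f x y z = f (f (malcev_J br x y z))"
proof -
  interpret Vector_Spaces.linear scaleC scaleC f
    using f by (simp add: malcev_morphism_def)
  \<comment> \<open>Oriented to pull \<open>f\<close> out of brackets: each summand
    \<open>f (br (f x) (f (br y z)))\<close> becomes \<open>f (f (br x (br y z)))\<close>, and
    additivity collects the three.\<close>
  have "br (f u) (f v) = f (br u v)" for u v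
    using f by (simp add: malcev_morphism_def)
  then show ?thesis
    by (simp add: hom_malcev_J_def malcev_J_def add)
qed

lemma malcev_J_morphism:
  assumes f: "malcev_morphism br f"
  shows "malcev_J br (f x) (f y) (f z) = f (malcev_J br x y z)"
proof -
  interpret Vector_Spaces.linear scaleC scaleC f
    using f by (simp add: malcev_morphism_def)
  have "br (f u) (f v) = f (br u v)" for u v
    using f by (simp add: malcev_morphism_def)
  then show ?thesis
    by (simp add: malcev_J_def add)
qed

theorem hom_banach_malcev_algebra_twist:
  assumes br: "banach_malcev_algebra br" and f: "bounded_clinear f" "malcev_morphism br f"
  shows "hom_banach_malcev_algebra (\<lambda>x y. f (br x y)) f"
proof -
  have mor: "br (f u) (f v) = f (br u v)" for u v
    using f by (simp add: malcev_morphism_def)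
  have malcev: "malcev_J br x y (br x z) = br (malcev_J br x y z) x" for x y z
    using br unfolding banach_malcev_algebra_def by blast
  have "continuous_cbilinear br"
    using br unfolding banach_malcev_algebra_def by blast
  show ?thesis
    unfolding hom_banach_malcev_algebra_def
  proof (intro conjI allI)
    show "continuous_cbilinear (\<lambda>x y. f (br x y))"
      using f(1) \<open>continuous_cbilinear br\<close> by (rule continuous_cbilinear_compose)
    show "\<exists>br'. banach_malcev_algebra br' \<and> (\<forall>x y. f (br x y) = f (br' x y))"
      using br by blast
    show "hom_malcev_J (\<lambda>x y. f (br x y)) f (f x) (f y) (f (br x z)) =
        f (br (hom_malcev_J (\<lambda>x y. f (br x y)) f x y z) (f (f x)))" for x y z
      by (simp add: hom_malcev_J_twist[OF f(2)] malcev_J_morphism[OF f(2)] malcev mor)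
  qed (fact f(1))
qed

section \<open>Uniform bounds and continuity of orbits for semigroups\<close>

lemma closed_cover_has_interior:
  fixes F :: "nat \<Rightarrow> 'a::{real_normed_vector, complete_space} set"
  assumes closed: "\<And>n. closed (F n)" and cover: "(\<Union>n. F n) = UNIV"
  obtains n where "interior (F n) \<noteq> {}"
proof (rule ccontr)
  assume "\<not> thesis"
  with that have "interior (F n) = {}" for n
    by blast
  \<comment> \<open>By Baire, closed sets without interior would have a countable union without
    interior, but this union is the whole space.\<close>
  then have "euclidean interior_of (\<Union>(range F)) = {}"
    using closed by (intro Baire_category_alt) (auto simp: completely_metrizable_space_euclidean)
  with cover show False
    by simp
qed

lemma semigroup_locally_bounded:
  assumes "strongly_continuous_semigroup \<alpha>"
  obtains \<delta> M where "\<delta> > 0" "M \<ge> 1" "\<And>t x. 0 \<le> t \<Longrightarrow> t \<le> \<delta> \<Longrightarrow> norm (\<alpha> t x) \<le> M * norm x"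
proof -
  have lin: "bounded_linear (\<alpha> t)" if "t \<ge> 0" for t
    using assms that by (simp add: strongly_continuous_semigroup_def bounded_clinear_imp_bounded_linear)
  have zero: "\<alpha> 0 x = x" and lim: "((\<lambda>t. \<alpha> t x) \<longlongrightarrow> x) (at_right 0)" for x
    using assms by (simp_all add: strongly_continuous_semigroup_def)
  \<comment> \<open>One index both shrinks the time interval and raises the bound, so countably many
    sets \<open>F n\<close> catch every orbit that is bounded near 0.\<close>
  define I where "I n = {0..inverse (real (Suc n))}" for n
  define F where "F n = (\<Inter>t\<in>I n. {x. norm (\<alpha> t x) \<le> real n})" for n
  have "closed (F n)" for n
    unfolding F_def
    by (intro closed_INT ballI closed_Collect_le continuous_intros bounded_linear.continuous_on[OF lin])
      (auto simp: I_def)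
  moreover have "\<exists>n. x \<in> F n" for x
  proof -
    have "eventually (\<lambda>t. dist (\<alpha> t x) x < 1) (at_right 0)"
      using lim[of x] by (rule tendstoD) simp
    then obtain d where d: "d > 0" "\<And>t. 0 < t \<Longrightarrow> t < d \<Longrightarrow> dist (\<alpha> t x) x < 1"
      by (auto simp: eventually_at_right_field)
    obtain m where m: "inverse (real (Suc m)) < d"
      using d(1) reals_Archimedean by blast
    obtain k where k: "norm x + 1 \<le> real k"
      using real_arch_simple by blast
    \<comment> \<open>\<open>m\<close> puts the interval inside the range where the orbit stays
      within 1 of \<open>x\<close>; \<open>k\<close> makes the bound exceed
      \<open>norm x + 1\<close>. The maximum serves both.\<close>
    have "norm (\<alpha> t x) \<le> real (max m k)" if "t \<in> I (max m k)" for t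
    proof -
      have "inverse (real (Suc (max m k))) \<le> inverse (real (Suc m))"
        by (intro le_imp_inverse_le) auto
      with that m have t: "0 \<le> t" "t < d"
        unfolding I_def atLeastAtMost_iff by linarith+
      \<comment> \<open>The right-hand limit says nothing at \<open>t = 0\<close>, where the orbit
        is at \<open>x\<close> itself.\<close>
      have "dist (\<alpha> t x) x < 1"
        using t d(2)[of t] zero[of x] by (cases "t = 0") auto
      then have "norm (\<alpha> t x) \<le> norm x + 1"
        using norm_triangle_sub[of "\<alpha> t x" x] by (simp add: dist_norm)
      with k show ?thesis
        by simp
    qed
    then show ?thesis
      by (auto simp: F_def)
  qed
  then have "(\<Union>n. F n) = UNIV"
    by blast
  ultimately obtain n where "interior (F n) \<noteq> {}"
    by (rule closed_cover_has_interior)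
  then obtain a where "a \<in> interior (F n)"
    by blast
  then obtain e where e: "e > 0" "cball a e \<subseteq> F n"
    by (auto simp: mem_interior_cball)
  \<comment> \<open>Rescaled to length \<open>e\<close>, the vector \<open>x\<close> is a difference
    of two points of \<open>cball a e\<close>. The images of both have norm at most
    \<open>n\<close>, whence the factor \<open>2 * n / e\<close>.\<close>
  have bound: "norm (\<alpha> t x) \<le> (2 * real n / e) * norm x" if t: "t \<in> I n" for t x
  proof (cases "x = 0")
    case True
    then show ?thesis
      using linear_0[OF bounded_linear.linear[OF lin]] t by (simp add: I_def)
  next
    case False
    interpret bounded_linear "\<alpha> t"
      using lin t by (simp add: I_def)
    let ?c = "e / norm x"
    have "a \<in> F n" "a + ?c *\<^sub>R x \<in> F n"
      using e False by (auto simp: dist_norm)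
    then have "norm (\<alpha> t a) \<le> n" "norm (\<alpha> t (a + ?c *\<^sub>R x)) \<le> n"
      using t by (auto simp: F_def)
    then have "norm (\<alpha> t (a + ?c *\<^sub>R x) - \<alpha> t a) \<le> 2 * real n"
      using norm_triangle_ineq4[of "\<alpha> t (a + ?c *\<^sub>R x)" "\<alpha> t a"] by linarith
    then have "?c * norm (\<alpha> t x) \<le> 2 * real n"
      using e by (simp add: add scaleR)
    then show ?thesis
      using e False by (simp add: field_simps)
  qed
  show ?thesis
  proof (rule that)
    \<comment> \<open>The maximum with 1 makes the powers of the bound increasing, as the passage to
      longer intervals requires.\<close>
    show "inverse (real (Suc n)) > 0" "max 1 (2 * real n / e) \<ge> 1"
      by auto
    show "norm (\<alpha> t x) \<le> max 1 (2 * real n / e) * norm x"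
      if "0 \<le> t" "t \<le> inverse (real (Suc n))" for t x
    proof -
      have "norm (\<alpha> t x) \<le> (2 * real n / e) * norm x"
        using that by (intro bound) (auto simp: I_def)
      also have "\<dots> \<le> max 1 (2 * real n / e) * norm x"
        by (intro mult_right_mono) auto
      finally show ?thesis .
    qed
  qed
qed

text \<open>Cut \<open>[0, T]\<close> into steps of length at most \<open>\<delta>\<close>; by the
  semigroup law each step costs one factor \<open>M\<close>.\<close>

lemma semigroup_bounded_on_compacts:
  assumes sg: "strongly_continuous_semigroup \<alpha>"
  obtains K where "K > 0" "\<And>t x. 0 \<le> t \<Longrightarrow> t \<le> T \<Longrightarrow> norm (\<alpha> t x) \<le> K * norm x"
proof -
  obtain \<delta> M where \<delta>: "\<delta> > 0" and M: "M \<ge> 1"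
    and loc: "\<And>t x. 0 \<le> t \<Longrightarrow> t \<le> \<delta> \<Longrightarrow> norm (\<alpha> t x) \<le> M * norm x"
    using semigroup_locally_bounded[OF sg] by metis
  have "norm (\<alpha> t x) \<le> M ^ Suc n * norm x" if "0 \<le> t" "t \<le> real (Suc n) * \<delta>" for n t x
    using that
  proof (induction n arbitrary: t)
    case 0
    then show ?case
      using loc by simp
  next
    case (Suc n)
    show ?case
    proof (cases "t \<le> \<delta>")
      \<comment> \<open>Removing a step could make the time negative, so the local bound is used
        directly and \<open>M \<ge> 1\<close> absorbs the surplus powers.\<close>
      case True
      have "norm (\<alpha> t x) \<le> M * norm x"
        using loc True Suc.prems by simp
      also have "\<dots> \<le> M ^ Suc (Suc n) * norm x"
        using M power_increasing[of 1 "Suc (Suc n)" M] by (intro mult_right_mono) simp_all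
      finally show ?thesis .
    next
      case False
      have "\<alpha> (r + s) x = \<alpha> r (\<alpha> s x)" if "r \<ge> 0" "s \<ge> 0" for r s
        using sg that by (simp add: strongly_continuous_semigroup_def)
      from this[of \<delta> "t - \<delta>"] have "\<alpha> t x = \<alpha> \<delta> (\<alpha> (t - \<delta>) x)"
        using \<delta> False by simp
      then have "norm (\<alpha> t x) \<le> M * norm (\<alpha> (t - \<delta>) x)"
        using loc[of \<delta> "\<alpha> (t - \<delta>) x"] \<delta> by simp
      also have "\<dots> \<le> M * (M ^ Suc n * norm x)"
        using Suc.prems False M by (intro mult_left_mono Suc.IH) (simp_all add: algebra_simps)
      finally show ?thesis
        by (simp add: mult.assoc)
    qed
  qed
  moreover obtain n where "T / \<delta> \<le> real n"
    using real_arch_simple by blast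
  then have "T \<le> real (Suc n) * \<delta>"
    using \<delta> by (simp add: field_simps)
  ultimately show ?thesis
    using M by (intro that[of "M ^ Suc n"]) auto
qed

lemma semigroup_orbit_continuous:
  assumes sg: "strongly_continuous_semigroup \<alpha>"
  shows "continuous_on {0..} (\<lambda>t. \<alpha> t x)"
  unfolding continuous_on_iff
proof (intro ballI allI impI)
  fix t \<epsilon> :: real
  assume "t \<in> {0..}" and \<epsilon>: "\<epsilon> > 0"
  then have t: "t \<ge> 0" by simp
  \<comment> \<open>The bound must be uniform in \<open>s\<close>: on approach to \<open>t\<close>
    from the left, the operator \<open>\<alpha> s\<close> factored out below varies with
    \<open>s\<close>.\<close>
  obtain K where K: "K > 0" "\<And>s y. 0 \<le> s \<Longrightarrow> s \<le> t + 1 \<Longrightarrow> norm (\<alpha> s y) \<le> K * norm y"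
    using semigroup_bounded_on_compacts[OF sg] by metis
  have "eventually (\<lambda>h. dist (\<alpha> h x) x < \<epsilon> / K) (at_right 0)"
    using sg \<epsilon> K(1) by (intro tendstoD) (simp_all add: strongly_continuous_semigroup_def)
  then obtain d where d: "d > 0" "\<And>h. 0 < h \<Longrightarrow> h < d \<Longrightarrow> dist (\<alpha> h x) x < \<epsilon> / K"
    by (auto simp: eventually_at_right_field)
  have step: "dist (\<alpha> (s + h) x) (\<alpha> s x) < \<epsilon>" if s: "0 \<le> s" "s \<le> t + 1" and h: "0 \<le> h" "h < d" for s h
  proof -
    have "dist (\<alpha> h x) x < \<epsilon> / K"
      using h d(2)[of h] \<epsilon> K(1) sg
      by (cases "h = 0") (auto simp: strongly_continuous_semigroup_def)
    have "\<alpha> (s + h) x = \<alpha> s (\<alpha> h x)" "bounded_linear (\<alpha> s)"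
      using sg s h
      by (simp_all add: strongly_continuous_semigroup_def bounded_clinear_imp_bounded_linear)
    then have "dist (\<alpha> (s + h) x) (\<alpha> s x) = norm (\<alpha> s (\<alpha> h x - x))"
      by (simp add: dist_norm linear_diff bounded_linear.linear)
    also have "\<dots> \<le> K * dist (\<alpha> h x) x"
      using K(2)[OF s] by (simp add: dist_norm)
    also have "\<dots> < \<epsilon>"
      using \<open>dist (\<alpha> h x) x < \<epsilon> / K\<close> K(1) by (simp add: field_simps)
    finally show ?thesis .
  qed
  \<comment> \<open>Whichever of \<open>s\<close> and \<open>t\<close> is earlier plays the base
    time in \<open>step\<close>, so the increment is never negative.\<close>
  have "dist (\<alpha> s x) (\<alpha> t x) < \<epsilon>" if s: "s \<ge> 0" "dist s t < d" for s
  proof (cases "s \<le> t")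
    case True
    then show ?thesis
      using step[of s "t - s"] s by (simp add: dist_real_def dist_commute)
  next
    case False
    then show ?thesis
      using step[of t "s - t"] s t by (simp add: dist_real_def)
  qed
  with d(1) show "\<exists>d>0. \<forall>s\<in>{0..}. dist s t < d \<longrightarrow> dist (\<alpha> s x) (\<alpha> t x) < \<epsilon>"
    by auto
qed

theorem theorem3p5:
  fixes br :: "'a::complex_banach \<Rightarrow> 'a \<Rightarrow> 'a"
    and \<alpha> :: "real \<Rightarrow> 'a \<Rightarrow> 'a"
    and br_t :: "real \<Rightarrow> 'a \<Rightarrow> 'a \<Rightarrow> 'a"
  assumes "banach_malcev_algebra br"
    and "strongly_continuous_semigroup \<alpha>"
    and "\<forall>t\<ge>0. malcev_morphism br (\<alpha> t)"
    and "\<forall>t\<ge>0. \<forall>x y. br_t t x y = \<alpha> t (br x y)"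
  shows "(\<forall>t\<ge>0. hom_banach_malcev_algebra (br_t t) (\<alpha> t)) \<and>
    (\<forall>x y. continuous_on {0..} (\<lambda>t. br_t t x y))"
proof (intro conjI allI impI)
  fix t :: real
  assume t: "t \<ge> 0"
  then have "br_t t = (\<lambda>x y. \<alpha> t (br x y))"
    using assms(4) by blast
  moreover have "bounded_clinear (\<alpha> t)"
    using t assms(2) by (simp add: strongly_continuous_semigroup_def)
  ultimately show "hom_banach_malcev_algebra (br_t t) (\<alpha> t)"
    using t assms(1,3) by (simp add: hom_banach_malcev_algebra_twist)
next
  fix x y
  \<comment> \<open>For fixed arguments, the twisted bracket traces the orbit of the single vector
    \<open>br x y\<close>.\<close>
  have "continuous_on {0..} (\<lambda>t. \<alpha> t (br x y))"
    using assms(2) by (rule semigroup_orbit_continuous)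
  then show "continuous_on {0..} (\<lambda>t. br_t t x y)"
    by (rule continuous_on_eq) (simp add: assms(4))
qed

end
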